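(* For every odd integer $n\ge 5$ there exists a finite simple graph of order $n$ that is not switching separable, but all of whose induced subgraphs of order $n-1$ are switching separable.
   Context: All graphs are finite and simple; "subgraph" means induced subgraph. For a graph $G=(V,E)$ and a set $U\subseteq V$ (possibly empty or equal to $V$), the $U$-switching of $G$ is the graph $G_U=(V,E\,\triangle\, E_{U,V\setminus U})$, where $E_{U,V\setminus U}$ is the edge set of the complete bipartite graph on $V$ with parts $U$ and $V\setminus U$. A set $W\subseteq V$ is called isolable if $2\le |W|\le |V|-2$ and some switching $G_U$ of $G$ contains no edge joining $W$ and $V\setminus W$. A graph is switching separable if its vertex set contains an isolable subset. *)

theory Defs
  imports "Graph_Theory.Digraph_Component"
begin

text \<open>
  A finite simple graph is a \<^locale>\<open>pair_graph\<close>: a finite, symmetric, irreflexive relation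
  on a finite vertex set. An undirected edge \<open>{u, v}\<close> is the pair of arcs \<open>(u, v)\<close>, \<open>(v, u)\<close>,
  so every set of arcs below is symmetric.
\<close>

definition complete_bipartite_arcs :: "'a set \<Rightarrow> 'a set \<Rightarrow> 'a rel" where
  "complete_bipartite_arcs A B = A \<times> B \<union> B \<times> A"

definition switching :: "'a pair_pre_digraph \<Rightarrow> 'a set \<Rightarrow> 'a pair_pre_digraph" where
  "switching G U =
     \<lparr> pverts = pverts G,
       parcs = sym_diff (parcs G) (complete_bipartite_arcs U (pverts G - U)) \<rparr>"

definition isolable :: "'a pair_pre_digraph \<Rightarrow> 'a set \<Rightarrow> bool" where
  "isolable G W \<longleftrightarrow>
     W \<subseteq> pverts G \<and> 2 \<le> card W \<and> card W + 2 \<le> card (pverts G) \<and>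
     (\<exists>U \<subseteq> pverts G.
        parcs (switching G U) \<inter> complete_bipartite_arcs W (pverts G - W) = {})"

definition switching_separable :: "'a pair_pre_digraph \<Rightarrow> bool" where
  "switching_separable G \<longleftrightarrow> (\<exists>W. isolable G W)"

end

theory Submission
  imports Defs
begin

text \<open>
  A set \<open>W\<close> is isolated by the \<open>U\<close>-switching iff the edges between \<open>W\<close> and its complement are
  exactly the pairs split by \<open>U\<close>, a condition symmetric in \<open>W\<close> and its complement. Hence, if the
  vertex \<open>v\<close> is isolated and (up to complementing) outside \<open>W\<close>, then \<open>W\<close> is
  isolable iff it is a nontrivial module of \<open>G - v\<close>. The critically prime half graph on
  \<open>0, \<dots>, n - 2\<close>, in which an even \<open>x\<close> is joined to every larger odd \<open>y\<close>, has no such module;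
  the same rule makes the even vertex \<open>n - 1\<close> isolated. Deleting any vertex \<open>x\<close> makes its two cyclic
  neighbours \<open>x - 1\<close> and \<open>x + 1\<close> modulo \<open>n\<close> an isolable pair.
\<close>

text \<open>A switched arc is present iff adjacency and separation by \<open>U\<close> disagree.
  Since the arcs are symmetric, testing those from \<open>W\<close> outwards suffices.\<close>

lemma isolable_iff:
  assumes "sym (parcs G)"
  shows "isolable G W \<longleftrightarrow>
    W \<subseteq> pverts G \<and> 2 \<le> card W \<and> card W + 2 \<le> card (pverts G) \<and>
    (\<exists>U \<subseteq> pverts G. \<forall>w \<in> W. \<forall>z \<in> pverts G - W. (w, z) \<in> parcs G \<longleftrightarrow> (w \<in> U) \<noteq> (z \<in> U))"
proof -
  have "parcs (switching G U) \<inter> complete_bipartite_arcs W (pverts G - W) = {} \<longleftrightarrow>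
      (\<forall>w \<in> W. \<forall>z \<in> pverts G - W. (w, z) \<in> parcs G \<longleftrightarrow> (w \<in> U) \<noteq> (z \<in> U))"
    if "W \<subseteq> pverts G" "U \<subseteq> pverts G" for U
  proof -
    have switch: "(w, z) \<in> parcs (switching G U) \<longleftrightarrow> \<not> ((w, z) \<in> parcs G \<longleftrightarrow> (w \<in> U) \<noteq> (z \<in> U))"
      "(z, w) \<in> parcs (switching G U) \<longleftrightarrow> (w, z) \<in> parcs (switching G U)"
      if "w \<in> pverts G" "z \<in> pverts G" for w z
    proof -
      have "(w, z) \<in> parcs G \<longleftrightarrow> (z, w) \<in> parcs G"
        using assms by (metis symD)
      then show "(w, z) \<in> parcs (switching G U) \<longleftrightarrow> \<not> ((w, z) \<in> parcs G \<longleftrightarrow> (w \<in> U) \<noteq> (z \<in> U))"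
        "(z, w) \<in> parcs (switching G U) \<longleftrightarrow> (w, z) \<in> parcs (switching G U)"
        using that by (simp_all add: switching_def complete_bipartite_arcs_def) blast+
    qed
    have "parcs (switching G U) \<inter> complete_bipartite_arcs W (pverts G - W) = {} \<longleftrightarrow>
        (\<forall>w \<in> W. \<forall>z \<in> pverts G - W.
          (w, z) \<notin> parcs (switching G U) \<and> (z, w) \<notin> parcs (switching G U))"
      unfolding complete_bipartite_arcs_def by blast
    also have "\<dots> \<longleftrightarrow>
        (\<forall>w \<in> W. \<forall>z \<in> pverts G - W. (w, z) \<in> parcs G \<longleftrightarrow> (w \<in> U) \<noteq> (z \<in> U))"
    proof (intro ball_cong refl)
      fix w z assume "w \<in> W" "z \<in> pverts G - W"
      then have "w \<in> pverts G" "z \<in> pverts G"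
        using \<open>W \<subseteq> pverts G\<close> by auto
      from switch[OF this]
      show "(w, z) \<notin> parcs (switching G U) \<and> (z, w) \<notin> parcs (switching G U) \<longleftrightarrow>
          ((w, z) \<in> parcs G \<longleftrightarrow> (w \<in> U) \<noteq> (z \<in> U))"
        by argo
    qed
    finally show ?thesis .
  qed
  then show ?thesis
    by (simp only: isolable_def cong: conj_cong)
qed

lemma isolableE:
  assumes "isolable G W" "sym (parcs G)"
  obtains U where "W \<subseteq> pverts G" "2 \<le> card W" "card W + 2 \<le> card (pverts G)" "U \<subseteq> pverts G"
    "\<forall>w \<in> W. \<forall>z \<in> pverts G - W. (w, z) \<in> parcs G \<longleftrightarrow> (w \<in> U) \<noteq> (z \<in> U)"
  using assms(1) unfolding isolable_iff[OF assms(2)] by blast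

text \<open>The same \<open>U\<close> works, as the pair condition is symmetric. This allows a
  chosen vertex to be assumed outside \<open>W\<close>.\<close>

lemma isolable_complement:
  assumes "sym (parcs G)" "finite (pverts G)" "isolable G W"
  shows "isolable G (pverts G - W)"
proof -
  obtain U where W: "W \<subseteq> pverts G" "2 \<le> card W" "card W + 2 \<le> card (pverts G)"
    and U: "U \<subseteq> pverts G"
    "\<forall>w \<in> W. \<forall>z \<in> pverts G - W. (w, z) \<in> parcs G \<longleftrightarrow> (w \<in> U) \<noteq> (z \<in> U)"
    using isolableE[OF assms(3,1)] by metis
  have "pverts G - (pverts G - W) = W"
    using W(1) by auto
  moreover have "card (pverts G - W) = card (pverts G) - card W"
    using W(1) assms(2) by (meson card_Diff_subset finite_subset)
  moreover have "(z, w) \<in> parcs G \<longleftrightarrow> (z \<in> U) \<noteq> (w \<in> U)" if "w \<in> W" "z \<in> pverts G - W" for w z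
    using U(2)[rule_format, OF that] assms(1) by (metis symD)
  ultimately show ?thesis
    using W U(1) unfolding isolable_iff[OF assms(1)] by (intro conjI exI[of _ U]) auto
qed

text \<open>The pair consists of twins if \<open>b\<close> holds and otherwise of vertices with
  opposite adjacencies to all others; one switching isolates it in both cases.\<close>

lemma isolable_pair:
  assumes "sym (parcs G)" "p \<in> pverts G" "q \<in> pverts G" "p \<noteq> q" "4 \<le> card (pverts G)"
    and "\<And>z. z \<in> pverts G - {p, q} \<Longrightarrow> ((p, z) \<in> parcs G \<longleftrightarrow> (q, z) \<in> parcs G) = b"
  shows "isolable G {p, q}"
proof -
  \<comment> \<open>With \<open>p\<close> kept outside, \<open>U\<close> must pick out the
    neighbours of \<open>p\<close>; \<open>q\<close> joins \<open>U\<close> exactly when its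
    adjacencies are opposite to those of \<open>p\<close>.\<close>
  define U where "U = {z \<in> pverts G - {p, q}. (p, z) \<in> parcs G} \<union> (if b then {} else {q})"
  have "U \<subseteq> pverts G"
    using assms(3) by (auto simp: U_def)
  moreover have "\<forall>w \<in> {p, q}. \<forall>z \<in> pverts G - {p, q}. (w, z) \<in> parcs G \<longleftrightarrow> (w \<in> U) \<noteq> (z \<in> U)"
    using assms(4,6) by (auto simp: U_def)
  ultimately show ?thesis
    using assms(2-5) unfolding isolable_iff[OF assms(1)] by auto
qed

text \<open>The rule does not mention the order \<open>n\<close>, so it also describes every induced
  subgraph. The second disjunct only symmetrizes the first.\<close>

definition half_edge :: "nat \<Rightarrow> nat \<Rightarrow> bool" where
  "half_edge x y \<longleftrightarrow> (even x \<and> odd y \<and> x < y) \<or> (even y \<and> odd x \<and> y < x)"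

definition half_graph :: "nat \<Rightarrow> nat pair_pre_digraph" where
  "half_graph n =
     \<lparr> pverts = {..<n}, parcs = {(x, y). x < n \<and> y < n \<and> half_edge x y} \<rparr>"

lemma pverts_half_graph [simp]: "pverts (half_graph n) = {..<n}"
  by (simp add: half_graph_def)

lemma parcs_half_graph [simp]:
  "(x, y) \<in> parcs (half_graph n) \<longleftrightarrow> x < n \<and> y < n \<and> half_edge x y"
  by (simp add: half_graph_def)

lemma half_edge_sym: "half_edge x y \<longleftrightarrow> half_edge y x"
  by (auto simp: half_edge_def)

lemma sym_half_graph: "sym (parcs (half_graph n))"
  by (auto intro!: symI simp: half_edge_sym)

lemma pair_graph_half_graph: "pair_graph (half_graph n)"
proof
  have "parcs (half_graph n) \<subseteq> {..<n} \<times> {..<n}"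
    by auto
  then show "finite (parcs (half_graph n))"
    by (rule finite_subset) simp
  show "symmetric (half_graph n)"
    using sym_half_graph by (simp add: symmetric_def)
qed (auto simp: half_edge_def)

text \<open>A vertex that distinguishes two members of a module \<open>W\<close> lies in
  \<open>W\<close>. This first gives members of both parities and then spreads to all
  vertices.\<close>

lemma half_edge_module_trivial:
  assumes "even m" "W \<subseteq> {..<m}" "2 \<le> card W"
    and mod: "\<And>w w' z. w \<in> W \<Longrightarrow> w' \<in> W \<Longrightarrow> z < m \<Longrightarrow> z \<notin> W \<Longrightarrow> half_edge w z = half_edge w' z"
  shows "W = {..<m}"
proof -
  have fin: "finite W"
    using assms(2) finite_subset by blast
  obtain x y where xy: "x \<in> W" "y \<in> W" "x < y"
    using assms(3) by (metis card_le_Suc0_iff_eq fin linorder_neqE_nat not_less_eq_eq numeral_2_eq_2)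
  have ym: "y < m"
    using xy assms(2) by auto
  have "\<exists>a b. a \<in> W \<and> b \<in> W \<and> even a \<and> odd b"
  proof (cases "even x = even y")
    case False
    then show ?thesis
      using xy by metis
  next
    case same: True
    show ?thesis
    proof (cases "even x")
      \<comment> \<open>The odd vertex \<open>Suc x\<close> is adjacent to \<open>x\<close> but not
        to the larger even \<open>y\<close>.\<close>
      case True
      have "Suc x < y"
        using same xy(3) True by (metis Suc_lessI even_Suc)
      then have "Suc x \<in> W"
        using mod[OF xy(1,2), of "Suc x"] True same ym by (auto simp: half_edge_def)
      then show ?thesis
        using True xy(1) by (metis even_Suc)
    next
      \<comment> \<open>Dually, the even vertex \<open>y - 1\<close> is adjacent to \<open>y\<close>
        but not to the smaller odd \<open>x\<close>.\<close>
      case False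
      have "x < y - 1"
        using same xy(3) False by presburger
      moreover have "even (y - 1)" "y - 1 < y" "y - 1 < m"
        using same False xy(3) ym by auto
      ultimately have "y - 1 \<in> W"
        using mod[OF xy(1,2), of "y - 1"] False same ym xy(3) by (auto simp: half_edge_def)
      then show ?thesis
        using \<open>even (y - 1)\<close> False xy(1) by metis
    qed
  qed
  then obtain a b where ab: "a \<in> W" "b \<in> W" "even a" "odd b"
    by auto
  \<comment> \<open>An even \<open>z\<close> below \<open>b\<close> is adjacent to \<open>b\<close>
    but not to \<open>a\<close>; an odd \<open>z\<close> above \<open>a\<close> is adjacent to
    \<open>a\<close> but not to \<open>b\<close>.\<close>
  have grow: "z \<in> W" if "a \<in> W" "b \<in> W" "even a" "odd b" "z < m" "if even z then z \<le> b else a \<le> z"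
    for a b z
    using mod[OF that(1,2), of z] that
    by (cases "z = a"; cases "z = b") (auto simp: half_edge_def split: if_splits)
  have m: "0 < m" "odd (m - 1)" "m - 1 < m"
    using ym assms(1) by auto
  \<comment> \<open>These are the extreme even and odd vertices, as \<open>m\<close> is even; taken
    as the new \<open>a\<close> and \<open>b\<close>, they capture every \<open>z\<close>.\<close>
  have "0 \<in> W" "m - 1 \<in> W"
    using grow[OF ab, of 0] grow[OF ab, of "m - 1"] m ab(1) assms(2) by auto
  then have "z \<in> W" if "z < m" for z
    using grow[of 0 "m - 1" z] m that by (cases "even z") auto
  then show ?thesis
    using assms(2) by auto
qed

lemma half_graph_not_separable:
  assumes "odd n"
  shows "\<not> switching_separable (half_graph n)"
proof
  \<comment> \<open>It suffices to exclude sets avoiding \<open>n - 1\<close>, since either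
    \<open>W\<close> or its complement does.\<close>
  have no: False if iso: "isolable (half_graph n) W" and last: "n - 1 \<notin> W" for W
  proof -
    obtain U where W: "W \<subseteq> {..<n}" "2 \<le> card W" "card W + 2 \<le> n"
      and arcs: "\<forall>w \<in> W. \<forall>z \<in> {..<n} - W.
        (w, z) \<in> parcs (half_graph n) \<longleftrightarrow> (w \<in> U) \<noteq> (z \<in> U)"
      using isolableE[OF iso sym_half_graph] unfolding pverts_half_graph card_lessThan by metis
    have U: "half_edge w z \<longleftrightarrow> (w \<in> U) \<noteq> (z \<in> U)" if "w \<in> W" "z < n" "z \<notin> W" for w z
    proof -
      have "w < n" "z \<in> {..<n} - W"
        using that W(1) by auto
      from arcs[rule_format, OF that(1) this(2)] show ?thesis
        using \<open>w < n\<close> that(2) by simp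
    qed
    have isolated: "\<not> half_edge w (n - 1)" if "w \<in> W" for w
      using that W(1) assms by (auto simp: half_edge_def)
    \<comment> \<open>Non-adjacency to \<open>n - 1\<close> puts all of \<open>W\<close> on one side
      of \<open>U\<close>, so adjacency to an outside \<open>z\<close> depends on \<open>z\<close>
      alone and \<open>W\<close> is a module.\<close>
    have U_const: "w \<in> U \<longleftrightarrow> n - 1 \<in> U" if "w \<in> W" for w
      using U[OF that, of "n - 1"] isolated[OF that] last W(3) by auto
    have "W \<subseteq> {..<n - 1}"
    proof
      fix w assume "w \<in> W"
      then have "w < n" "w \<noteq> n - 1"
        using W(1) last by auto
      then show "w \<in> {..<n - 1}"
        by simp
    qed
    then have "W = {..<n - 1}"
      using W(2) assms U U_const by (intro half_edge_module_trivial) auto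
    then show False
      using W(3) by auto
  qed
  assume "switching_separable (half_graph n)"
  then obtain W where W: "isolable (half_graph n) W"
    by (auto simp: switching_separable_def)
  show False
    using no[OF W] no[OF isolable_complement[OF sym_half_graph _ W]] by auto
qed

theorem theorem2:
  fixes n :: nat
  assumes "odd n" and "5 \<le> n"
  shows "\<exists>G :: nat pair_pre_digraph.
           pair_graph G \<and> card (pverts G) = n \<and>
           \<not> switching_separable G \<and>
           (\<forall>H :: nat pair_pre_digraph.
              induced_subgraph (with_proj H) (with_proj G) \<and> card (pverts H) = n - 1
                \<longrightarrow> switching_separable H)"
proof (intro exI[of _ "half_graph n"] conjI allI impI)
  fix H :: "nat pair_pre_digraph"
  assume "induced_subgraph (with_proj H) (with_proj (half_graph n)) \<and> card (pverts H) = n - 1"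
  then have sub: "pverts H \<subseteq> {..<n}" and card: "card (pverts H) = n - 1"
    and arcs: "\<And>x y. (x, y) \<in> parcs H \<longleftrightarrow> x \<in> pverts H \<and> y \<in> pverts H \<and> half_edge x y"
    by (auto simp: induced_subgraph_def subgraph_def)
  have "card ({..<n} - pverts H) = 1"
    using sub card assms(2) finite_subset[OF sub] by (simp add: card_Diff_subset)
  then obtain x where "{..<n} - pverts H = {x}"
    by (auto simp: card_1_singleton_iff)
  then have H: "pverts H = {..<n} - {x}" and x: "x < n"
    using sub by auto
  have sym: "sym (parcs H)"
    by (auto intro!: symI simp: arcs half_edge_sym)
  consider "x = 0" | "x = n - 1" | "0 < x" "x < n - 1"
    using x by linarith
  then have "\<exists>p q b. p \<in> {..<n} - {x} \<and> q \<in> {..<n} - {x} \<and> p \<noteq> q \<and>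
    (\<forall>z \<in> {..<n} - {x} - {p, q}. (half_edge p z \<longleftrightarrow> half_edge q z) = b)"
  proof cases
    \<comment> \<open>The only neighbour of \<open>1\<close> was \<open>0\<close>, and
      \<open>n - 1\<close> is isolated, so both are now isolated twins.\<close>
    case 1
    have "\<not> half_edge 1 z" "\<not> half_edge (n - 1) z" if "z \<in> {..<n} - {0}" for z
      using that assms by (auto simp: half_edge_def)
    then show ?thesis
      using assms 1 by (intro exI[of _ 1] exI[of _ "n - 1"] exI[of _ True]) auto
  next
    \<comment> \<open>Here \<open>0\<close> sees exactly the odd and \<open>n - 2\<close> exactly
      the even remaining vertices, hence \<open>b\<close> is \<open>False\<close>.\<close>
    case 2
    have "half_edge 0 z \<noteq> half_edge (n - 2) z" if "z \<in> {..<n} - {n - 1} - {0, n - 2}" for z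
    proof -
      have "0 < z" "z < n - 2"
        using that by auto
      then show ?thesis
        using assms by (auto simp: half_edge_def)
    qed
    then show ?thesis
      using assms 2 by (intro exI[of _ 0] exI[of _ "n - 2"] exI[of _ False]) auto
  next
    \<comment> \<open>The neighbours of \<open>x\<close> have equal parity and only \<open>x\<close>
      lies between them, so they are twins once it is gone.\<close>
    case 3
    have "half_edge (x - 1) z = half_edge (x + 1) z" if "z \<in> {..<n} - {x} - {x - 1, x + 1}" for z
    proof -
      have "z < x - 1 \<or> x + 1 < z"
        using that by auto
      moreover have "even (x - 1) = even (x + 1)"
        using 3 by auto
      ultimately show ?thesis
        by (auto simp: half_edge_def)
    qed
    then show ?thesis
      using 3 by (intro exI[of _ "x - 1"] exI[of _ "x + 1"] exI[of _ True]) auto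
  qed
  then obtain p q b where pq: "p \<in> {..<n} - {x}" "q \<in> {..<n} - {x}" "p \<noteq> q"
    and b: "\<And>z. z \<in> {..<n} - {x} - {p, q} \<Longrightarrow> (half_edge p z \<longleftrightarrow> half_edge q z) = b"
    by blast
  have "isolable H {p, q}"
  \<comment> \<open>From \<open>5 \<le> n\<close>, \<open>H\<close> has at least four vertices, so
    two remain outside the pair.\<close>
  proof (rule isolable_pair[OF sym])
    show "((p, z) \<in> parcs H \<longleftrightarrow> (q, z) \<in> parcs H) = b" if "z \<in> pverts H - {p, q}" for z
      using b[of z] that pq by (simp add: H arcs)
  qed (use pq card assms in \<open>simp_all add: H\<close>)
  then show "switching_separable H"
    by (auto simp: switching_separable_def)
qed (use assms pair_graph_half_graph half_graph_not_separable in auto)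

end
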